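(* Let $A$ be an integral domain with fraction field $\mathbb{K}$, and let $x$ be a single indeterminate. Let $f\in \mathbb{K}\llbracket x^{\mathbb{R}_+}\rrbracket$, written $f=\sum_{s\in\mathbb{R}_+}a_s x^s$, be algebraic and separable over $A\llbracket x^{\mathbb{R}_+}\rrbracket$ (i.e. over its fraction field). Then there exists a nonzero $a\in A$ such that $$\forall s\in\mathbb{R}_+,\qquad a^{\lceil s\rceil+1}a_s\in A.$$
   Context: For a commutative ring $R$, $R\llbracket x^{\mathbb{R}_+}\rrbracket$ denotes the set of formal sums $\sum_{s\in\mathbb{R}_+}a_s x^s$ with $a_s\in R$ such that for every $r\in\mathbb{R}$ the set $\{s\in\mathbb{R}_+ : a_s\neq 0,\ s\le r\}$ is finite; with the usual addition and (Cauchy) multiplication this is a commutative ring (a subring of the ring of Hahn series). $A\llbracket x^{\mathbb{R}_+}\rrbracket$ is viewed as a subring of $\mathbb{K}\llbracket x^{\mathbb{R}_+}\rrbracket$. *)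

theory Defs
  imports "HOL-Computational_Algebra.Computational_Algebra"
begin

section \<open>Generalised power series with exponents in the non-negative reals\<close>

text \<open>
  A series is represented by its coefficient function. The exponents form the type \<^typ>\<open>real\<close>,
  and all coefficients at negative exponents are required to vanish.
\<close>

typedef (overloaded) 'a gps =
  "{a :: real \<Rightarrow> 'a::zero. (\<forall>s<0. a s = 0) \<and> (\<forall>r. finite {s. a s \<noteq> 0 \<and> s \<le> r})}"
  morphisms gps_nth Abs_gps
  by (rule exI[of _ "\<lambda>_. 0"]) simp

setup_lifting type_definition_gps

lemma gps_eqI: "(\<And>s. gps_nth f s = gps_nth g s) \<Longrightarrow> f = g"
  by (metis ext gps_nth_inject)

lemma gps_nth_neg: "s < 0 \<Longrightarrow> gps_nth f s = 0"
  using gps_nth[of f] by auto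

lemma gps_nth_nonzero: "gps_nth f s \<noteq> 0 \<Longrightarrow> 0 \<le> s"
  using gps_nth_neg[of s f] by force

lemma gps_finite: "finite {s. gps_nth f s \<noteq> 0 \<and> s \<le> r}"
  using gps_nth[of f] by auto

instantiation gps :: (zero) zero
begin
lift_definition zero_gps :: "'a gps" is "\<lambda>_. 0" by simp
instance ..
end

lemma gps_nth_0 [simp]: "gps_nth 0 s = 0"
  by transfer simp

instantiation gps :: (ab_group_add) ab_group_add
begin

lift_definition plus_gps :: "'a gps \<Rightarrow> 'a gps \<Rightarrow> 'a gps" is "\<lambda>a b s. a s + b s"
proof -
  fix a b :: "real \<Rightarrow> 'a"
  assume a: "(\<forall>s<0. a s = 0) \<and> (\<forall>r. finite {s. a s \<noteq> 0 \<and> s \<le> r})"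
    and b: "(\<forall>s<0. b s = 0) \<and> (\<forall>r. finite {s. b s \<noteq> 0 \<and> s \<le> r})"
  have "finite {s. a s + b s \<noteq> 0 \<and> s \<le> r}" for r
    by (rule finite_subset[of _ "{s. a s \<noteq> 0 \<and> s \<le> r} \<union> {s. b s \<noteq> 0 \<and> s \<le> r}"])
       (use a b in auto)
  with a b show "(\<forall>s<0. a s + b s = 0) \<and> (\<forall>r. finite {s. a s + b s \<noteq> 0 \<and> s \<le> r})"
    by simp
qed

lift_definition uminus_gps :: "'a gps \<Rightarrow> 'a gps" is "\<lambda>a s. - a s"
  by simp

definition minus_gps :: "'a gps \<Rightarrow> 'a gps \<Rightarrow> 'a gps" where
  "minus_gps f g = f + - g"

instance
  by standard (unfold minus_gps_def, (transfer; simp add: add_ac)+)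

end

lemma gps_nth_add [simp]: "gps_nth (f + g) s = gps_nth f s + gps_nth g s"
  by transfer simp

lemma gps_nth_uminus [simp]: "gps_nth (- f) s = - gps_nth f s"
  by transfer simp

lemma gps_conv_finite:
  assumes "finite {s. a s \<noteq> 0 \<and> s \<le> r}" "finite {s. b s \<noteq> 0 \<and> s \<le> r}"
    and "\<forall>s<0. a s = 0" "\<forall>s<0. b s = 0" "(s::real) \<le> r"
  shows "{(t, u). t + u = s \<and> a t \<noteq> 0 \<and> b u \<noteq> 0}
    \<subseteq> {s. a s \<noteq> 0 \<and> s \<le> r} \<times> {s. b s \<noteq> 0 \<and> s \<le> r}"
proof -
  have "t \<le> r \<and> u \<le> r" if "t + u = s" "a t \<noteq> 0" "b u \<noteq> 0" for t u
  proof -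
    have "\<not> t < 0" "\<not> u < 0" using assms(3,4) that by auto
    with that(1) assms(5) show ?thesis by auto
  qed
  then show ?thesis by auto
qed

text \<open>Cauchy product: the sum over all \<open>t + u = s\<close>, restricted to its finitely many nonzero terms.\<close>

instantiation gps :: (comm_ring_1) "{times, one}"
begin

lift_definition one_gps :: "'a gps" is "\<lambda>s. if s = 0 then 1 else 0"
  by (auto intro: finite_subset[of _ "{0}"])

lift_definition times_gps :: "'a gps \<Rightarrow> 'a gps \<Rightarrow> 'a gps" is
  "\<lambda>a b s. \<Sum>(t, u) \<in> {(t, u). t + u = s \<and> a t \<noteq> 0 \<and> b u \<noteq> 0}. a t * b u"
proof -
  fix a b :: "real \<Rightarrow> 'a"
  assume a: "(\<forall>s<0. a s = 0) \<and> (\<forall>r. finite {s. a s \<noteq> 0 \<and> s \<le> r})"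
    and b: "(\<forall>s<0. b s = 0) \<and> (\<forall>r. finite {s. b s \<noteq> 0 \<and> s \<le> r})"
  let ?P = "\<lambda>s. {(t, u). t + u = s \<and> a t \<noteq> 0 \<and> b u \<noteq> 0}"
  let ?c = "\<lambda>s. \<Sum>(t, u) \<in> ?P s. a t * b u"
  have ne: "?P s \<noteq> {}" if "?c s \<noteq> 0" for s
    using that by (metis (no_types, lifting) sum.empty)
  have "?c s = 0" if "s < 0" for s
  proof (rule ccontr)
    assume "?c s \<noteq> 0"
    from ne[OF this] obtain t u where tu: "t + u = s" "a t \<noteq> 0" "b u \<noteq> 0" by auto
    then have "\<not> t < 0" "\<not> u < 0" using a b by auto
    with tu that show False by simp
  qed
  moreover have "finite {s. ?c s \<noteq> 0 \<and> s \<le> r}" for r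
  proof (rule finite_subset)
    show "{s. ?c s \<noteq> 0 \<and> s \<le> r} \<subseteq>
      (\<lambda>(t, u). t + u) ` ({s. a s \<noteq> 0 \<and> s \<le> r} \<times> {s. b s \<noteq> 0 \<and> s \<le> r})"
    proof
      fix s assume "s \<in> {s. ?c s \<noteq> 0 \<and> s \<le> r}"
      then have "?c s \<noteq> 0" "s \<le> r" by auto
      from ne[OF this(1)] obtain t u where tu: "(t, u) \<in> ?P s" by auto
      then have "(t, u) \<in> {s. a s \<noteq> 0 \<and> s \<le> r} \<times> {s. b s \<noteq> 0 \<and> s \<le> r}"
        using gps_conv_finite[of a r b s] a b \<open>s \<le> r\<close> by blast
      with tu show "s \<in> (\<lambda>(t, u). t + u) ` ({s. a s \<noteq> 0 \<and> s \<le> r} \<times> {s. b s \<noteq> 0 \<and> s \<le> r})"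
        by force
    qed
  qed (use a b in auto)
  ultimately show "(\<forall>s<0. ?c s = 0) \<and> (\<forall>r. finite {s. ?c s \<noteq> 0 \<and> s \<le> r})" by blast
qed

instance ..

end

lemma gps_nth_1: "gps_nth 1 s = (if s = 0 then 1 else 0)"
  by transfer simp

lemma gps_nth_mult:
  "gps_nth (f * g) s =
    (\<Sum>(t, u) \<in> {(t, u). t + u = s \<and> gps_nth f t \<noteq> 0 \<and> gps_nth g u \<noteq> 0}. gps_nth f t * gps_nth g u)"
  by transfer simp

lemma gps_nth_mult_superset:
  assumes "finite T" "finite U"
    and T: "{t. gps_nth f t \<noteq> 0 \<and> t \<le> s} \<subseteq> T"
    and U: "{u. gps_nth g u \<noteq> 0 \<and> u \<le> s} \<subseteq> U"
  shows "gps_nth (f * g) s =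
    (\<Sum>t\<in>T. \<Sum>u\<in>U. if t + u = s then gps_nth f t * gps_nth g u else 0)"
proof -
  let ?P = "{(t, u). t + u = s \<and> gps_nth f t \<noteq> 0 \<and> gps_nth g u \<noteq> 0}"
  have sub: "?P \<subseteq> T \<times> U"
    using gps_conv_finite[of "gps_nth f" s "gps_nth g" s] gps_finite gps_nth_neg T U by blast
  have "gps_nth (f * g) s = (\<Sum>(t, u)\<in>?P. if t + u = s then gps_nth f t * gps_nth g u else 0)"
    unfolding gps_nth_mult by (rule sum.cong) auto
  also have "\<dots> = (\<Sum>(t, u)\<in>T \<times> U. if t + u = s then gps_nth f t * gps_nth g u else 0)"
    by (rule sum.mono_neutral_left) (use sub assms in \<open>auto split: if_splits\<close>)
  finally show ?thesis by (simp add: sum.cartesian_product)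
qed

lemma sum_rotate3:
  "(\<Sum>a\<in>A. \<Sum>b\<in>B. \<Sum>c\<in>C. F a b c) = (\<Sum>b\<in>B. \<Sum>c\<in>C. \<Sum>a\<in>A. F a b c)"
  by (rule trans[OF sum.swap], rule sum.cong[OF refl], rule sum.swap)

lemma sum_rotate4:
  "(\<Sum>a\<in>A. \<Sum>b\<in>B. \<Sum>c\<in>C. \<Sum>d\<in>D. F a b c d) =
   (\<Sum>b\<in>B. \<Sum>c\<in>C. \<Sum>d\<in>D. \<Sum>a\<in>A. F a b c d)"
  by (rule trans[OF sum.swap], rule sum.cong[OF refl], rule sum_rotate3)

instance gps :: (comm_ring_1) comm_ring_1
proof
  fix f g h :: "'a gps"
  show "f * g * h = f * (g * h)"
  proof (rule gps_eqI)
    fix s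
    define T where "T = {t. gps_nth f t \<noteq> 0 \<and> t \<le> s}"
    define U where "U = {t. gps_nth g t \<noteq> 0 \<and> t \<le> s}"
    define V where "V = {t. gps_nth h t \<noteq> 0 \<and> t \<le> s}"
    define W where "W = {t. gps_nth (f * g) t \<noteq> 0 \<and> t \<le> s} \<union> (\<lambda>(t, u). t + u) ` (T \<times> U)"
    define X where "X = {t. gps_nth (g * h) t \<noteq> 0 \<and> t \<le> s} \<union> (\<lambda>(t, u). t + u) ` (U \<times> V)"
    have fin: "finite T" "finite U" "finite V" "finite W" "finite X"
      by (simp_all add: T_def U_def V_def W_def X_def gps_finite)
    let ?z = "\<lambda>t u v. if t + u + v = s then gps_nth f t * gps_nth g u * gps_nth h v else 0"
    have fg: "gps_nth (f * g) w * gps_nth h v =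
        (\<Sum>t\<in>T. \<Sum>u\<in>U. if t + u = w then gps_nth f t * gps_nth g u * gps_nth h v else 0)"
      if "w + v = s" "v \<in> V" for w v
    proof -
      have "w \<le> s" using that gps_nth_nonzero[of h v] by (auto simp: V_def)
      then show ?thesis
        by (subst gps_nth_mult_superset[of T U]) (use fin in \<open>auto simp: T_def U_def sum_distrib_right intro!: sum.cong\<close>)
    qed
    have gh: "gps_nth f t * gps_nth (g * h) w =
        (\<Sum>u\<in>U. \<Sum>v\<in>V. if u + v = w then gps_nth f t * gps_nth g u * gps_nth h v else 0)"
      if "t + w = s" "t \<in> T" for w t
    proof -
      have "w \<le> s" using that gps_nth_nonzero[of f t] by (auto simp: T_def)
      then show ?thesis
        by (subst gps_nth_mult_superset[of U V]) (use fin in \<open>auto simp: U_def V_def sum_distrib_left mult.assoc intro!: sum.cong\<close>)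
    qed
    have "gps_nth (f * g * h) s =
        (\<Sum>w\<in>W. \<Sum>v\<in>V. if w + v = s then gps_nth (f * g) w * gps_nth h v else 0)"
      by (rule gps_nth_mult_superset) (use fin in \<open>auto simp: W_def V_def\<close>)
    also have "\<dots> = (\<Sum>w\<in>W. \<Sum>v\<in>V. \<Sum>t\<in>T. \<Sum>u\<in>U. if w = t + u then ?z t u v else 0)"
      by (intro sum.cong refl) (auto simp: fg intro!: sum.cong sum.neutral)
    also have "\<dots> = (\<Sum>v\<in>V. \<Sum>t\<in>T. \<Sum>u\<in>U. \<Sum>w\<in>W. if w = t + u then ?z t u v else 0)"
      by (rule sum_rotate4)
    also have "\<dots> = (\<Sum>v\<in>V. \<Sum>t\<in>T. \<Sum>u\<in>U. ?z t u v)"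
      by (intro sum.cong refl, subst sum.delta) (use fin in \<open>auto simp: W_def\<close>)
    also have "\<dots> = (\<Sum>t\<in>T. \<Sum>u\<in>U. \<Sum>v\<in>V. ?z t u v)"
      by (rule sum_rotate3)
    also have "\<dots> = (\<Sum>t\<in>T. \<Sum>u\<in>U. \<Sum>v\<in>V. \<Sum>w\<in>X. if w = u + v then ?z t u v else 0)"
      by (intro sum.cong refl, subst sum.delta) (use fin in \<open>auto simp: X_def\<close>)
    also have "\<dots> = (\<Sum>t\<in>T. \<Sum>w\<in>X. \<Sum>u\<in>U. \<Sum>v\<in>V. if w = u + v then ?z t u v else 0)"
      by (rule sum.cong[OF refl], rule sum_rotate3[symmetric])
    also have "\<dots> = (\<Sum>t\<in>T. \<Sum>w\<in>X. if t + w = s then gps_nth f t * gps_nth (g * h) w else 0)"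
      by (intro sum.cong refl) (auto simp: gh add.assoc intro!: sum.cong sum.neutral)
    also have "\<dots> = gps_nth (f * (g * h)) s"
      by (rule gps_nth_mult_superset[symmetric]) (use fin in \<open>auto simp: X_def T_def\<close>)
    finally show "gps_nth (f * g * h) s = gps_nth (f * (g * h)) s" .
  qed
  show "f * g = g * f"
  proof (rule gps_eqI)
    fix s
    show "gps_nth (f * g) s = gps_nth (g * f) s"
      by (subst (1 2) gps_nth_mult_superset[OF gps_finite gps_finite order.refl order.refl],
          subst sum.swap, intro sum.cong refl)
         (auto simp: mult.commute add.commute)
  qed
  show "1 * f = f"
  proof (rule gps_eqI)
    fix s
    have "gps_nth (1 * f) s = (\<Sum>t\<in>{0}. \<Sum>u\<in>insert s {u. gps_nth f u \<noteq> 0 \<and> u \<le> s}.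
        if t + u = s then gps_nth 1 t * gps_nth f u else 0)"
      by (rule gps_nth_mult_superset) (auto simp: gps_nth_1 gps_finite)
    then show "gps_nth (1 * f) s = gps_nth f s"
      by (simp add: gps_nth_1 gps_finite)
  qed
  show "(f + g) * h = f * h + g * h"
  proof (rule gps_eqI)
    fix s
    define T where "T = {t. gps_nth f t \<noteq> 0 \<and> t \<le> s} \<union> {t. gps_nth g t \<noteq> 0 \<and> t \<le> s}"
    define U where "U = {u. gps_nth h u \<noteq> 0 \<and> u \<le> s}"
    have fin: "finite T" "finite U" by (simp_all add: T_def U_def gps_finite)
    have "gps_nth ((f + g) * h) s =
        (\<Sum>t\<in>T. \<Sum>u\<in>U. if t + u = s then gps_nth (f + g) t * gps_nth h u else 0)"
      by (rule gps_nth_mult_superset) (use fin in \<open>auto simp: T_def U_def\<close>)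
    moreover have "gps_nth (f * h) s =
        (\<Sum>t\<in>T. \<Sum>u\<in>U. if t + u = s then gps_nth f t * gps_nth h u else 0)"
      by (rule gps_nth_mult_superset) (use fin in \<open>auto simp: T_def U_def\<close>)
    moreover have "gps_nth (g * h) s =
        (\<Sum>t\<in>T. \<Sum>u\<in>U. if t + u = s then gps_nth g t * gps_nth h u else 0)"
      by (rule gps_nth_mult_superset) (use fin in \<open>auto simp: T_def U_def\<close>)
    ultimately show "gps_nth ((f + g) * h) s = gps_nth (f * h + g * h) s"
      by (simp add: sum.distrib[symmetric] if_distrib distrib_right cong: if_cong)
  qed
  show "(0 :: 'a gps) \<noteq> 1"
  proof
    assume "(0 :: 'a gps) = 1"
    then have "gps_nth (0 :: 'a gps) 0 = gps_nth 1 0" by simp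
    then show False by (simp add: gps_nth_1)
  qed
qed

lemma gps_order_exists:
  assumes "f \<noteq> 0"
  obtains m where "gps_nth f m \<noteq> 0" "\<And>t. gps_nth f t \<noteq> 0 \<Longrightarrow> m \<le> t"
proof -
  obtain r where r: "gps_nth f r \<noteq> 0"
    using assms gps_eqI[of f 0] by auto
  let ?S = "{s. gps_nth f s \<noteq> 0 \<and> s \<le> r}"
  have S: "finite ?S" "?S \<noteq> {}" using r by (auto simp: gps_finite)
  show ?thesis
  proof (rule that[of "Min ?S"])
    have M: "Min ?S \<in> ?S" by (rule Min_in[OF S])
    then show "gps_nth f (Min ?S) \<noteq> 0" by auto
    fix t assume t: "gps_nth f t \<noteq> 0"
    show "Min ?S \<le> t"
    proof (cases "t \<le> r")
      case True
      then show ?thesis using t by (intro Min_le[OF S(1)]) auto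
    next
      case False
      then show ?thesis using M by auto
    qed
  qed
qed

instance gps :: (idom) idom
proof
  fix f g :: "'a gps"
  assume "f \<noteq> 0" "g \<noteq> 0"
  obtain m where m: "gps_nth f m \<noteq> 0" "\<And>t. gps_nth f t \<noteq> 0 \<Longrightarrow> m \<le> t"
    by (rule gps_order_exists[OF \<open>f \<noteq> 0\<close>]) blast
  obtain n where n: "gps_nth g n \<noteq> 0" "\<And>t. gps_nth g t \<noteq> 0 \<Longrightarrow> n \<le> t"
    by (rule gps_order_exists[OF \<open>g \<noteq> 0\<close>]) blast
  have "{(t, u). t + u = m + n \<and> gps_nth f t \<noteq> 0 \<and> gps_nth g u \<noteq> 0} = {(m, n)}"
    using m n by (auto; smt (verit))
  then have "gps_nth (f * g) (m + n) = gps_nth f m * gps_nth g n"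
    by (simp add: gps_nth_mult)
  with m(1) n(1) have "gps_nth (f * g) (m + n) \<noteq> 0" by simp
  then show "f * g \<noteq> 0" by auto
qed

text \<open>The series all of whose coefficients lie in \<open>R\<close>.\<close>

definition gps_over :: "'a::zero set \<Rightarrow> 'a gps set" where
  "gps_over R = {f. \<forall>s. gps_nth f s \<in> R}"


section \<open>Algebraic and separable elements\<close>

text \<open>The fraction field of a subring \<open>S\<close> of a domain, inside the fraction field of the domain.\<close>

definition fraction_field_of :: "'a::idom set \<Rightarrow> 'a fract set" where
  "fraction_field_of S = {Fract p q | p q. p \<in> S \<and> q \<in> S \<and> q \<noteq> 0}"

definition polys_over :: "'a::zero set \<Rightarrow> 'a poly set" where
  "polys_over F = {p. set (coeffs p) \<subseteq> F}"

definition algebraic_over :: "'a::field set \<Rightarrow> 'a \<Rightarrow> bool" where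
  "algebraic_over F \<alpha> \<longleftrightarrow> (\<exists>p\<in>polys_over F. p \<noteq> 0 \<and> poly p \<alpha> = 0)"

definition is_minimal_poly :: "'a::field set \<Rightarrow> 'a \<Rightarrow> 'a poly \<Rightarrow> bool" where
  "is_minimal_poly F \<alpha> p \<longleftrightarrow>
     p \<in> polys_over F \<and> lead_coeff p = 1 \<and> poly p \<alpha> = 0 \<and>
     (\<forall>q\<in>polys_over F. q \<noteq> 0 \<and> poly q \<alpha> = 0 \<longrightarrow> degree p \<le> degree q)"

text \<open>
  A polynomial is separable (has only simple roots in an algebraic closure) if it is coprime to
  its derivative. Coprimality is insensitive to field extensions, so it does not matter that it
  is taken in the polynomial ring over the ambient field rather than over \<open>F\<close>.
\<close>

definition separable_poly :: "'a::field poly \<Rightarrow> bool" where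
  "separable_poly p \<longleftrightarrow> coprime p (pderiv p)"

definition separable_over :: "'a::field set \<Rightarrow> 'a \<Rightarrow> bool" where
  "separable_over F \<alpha> \<longleftrightarrow> (\<exists>p. is_minimal_poly F \<alpha> p \<and> separable_poly p)"

end

(*
  Clear denominators in the minimal polynomial to get P over A[[x]] with P(f) = 0 and
  P'(f) of finite order v. Split f = f0 + h with f0 the finite part of f below x^(v+2), and expand
  Q(y) = c P(f0 + y), where the constant c makes Q integral. If b is the coefficient at x^v of the
  linear coefficient Q_1 of Q, then comparing coefficients at x^(s+v) in Q(h) = 0 expresses b h_s
  through coefficients h_t with smaller t. Since the exponents of f need not lie in a discrete
  monoid, the number of divisions by b is controlled by a slope instead of by counting steps:
  if Q_1 has no exponent strictly between v and v + eta, then b^m h_s is integral for some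
  m <= (s - v - eta) / eta.
*)
theory Submission
  imports Defs
begin

section \<open>Subrings and series with controlled denominators\<close>

locale subring_set =
  fixes R :: "'a::comm_ring_1 set"
  assumes one_mem: "1 \<in> R"
    and add_mem: "x \<in> R \<Longrightarrow> y \<in> R \<Longrightarrow> x + y \<in> R"
    and uminus_mem: "x \<in> R \<Longrightarrow> - x \<in> R"
    and mult_mem: "x \<in> R \<Longrightarrow> y \<in> R \<Longrightarrow> x * y \<in> R"
begin

lemma zero_mem: "0 \<in> R"
  using add_mem[OF one_mem uminus_mem[OF one_mem]] by simp

lemma power_mem: "x \<in> R \<Longrightarrow> x ^ n \<in> R"
  by (induction n) (auto intro: one_mem mult_mem)

text \<open>Horner's scheme: each step multiplies by \<open>[:c, 1:]\<close> and adds a constant, so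
  only ring operations inside \<open>R\<close> occur.\<close>

lemma coeff_pcompose_shift_mem:
  assumes "\<And>i. coeff p i \<in> R" "c \<in> R"
  shows "coeff (pcompose p [:c, 1:]) i \<in> R"
  using assms(1)
proof (induction p arbitrary: i)
  case 0
  then show ?case by simp
next
  case (pCons a p)
  have a: "a \<in> R" using pCons.prems[of 0] by simp
  have p: "coeff p j \<in> R" for j using pCons.prems[of "Suc j"] by simp
  define r where "r = pcompose p [:c, 1:]"
  have r: "coeff r j \<in> R" for j unfolding r_def by (rule pCons.IH[OF p])
  have "pcompose (pCons a p) [:c, 1:] = [:a:] + (smult c r + pCons 0 r)"
    by (simp add: pcompose_pCons r_def)
  then show ?case
    by (cases i) (auto intro!: add_mem mult_mem a r assms(2))
qed

end

lemma subring_set_UNIV: "subring_set UNIV"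
  by standard auto

lemma subring_set_range_to_fract: "subring_set (range (to_fract :: 'a::idom \<Rightarrow> 'a fract))"
proof
  show "1 \<in> range (to_fract :: 'a \<Rightarrow> _)" by (metis rangeI to_fract_1)
  fix x y :: "'a fract"
  assume "x \<in> range to_fract"
  then obtain u where u: "x = to_fract u" by blast
  show "- x \<in> range to_fract" unfolding u by (metis rangeI to_fract_uminus)
  assume "y \<in> range to_fract"
  then obtain w where w: "y = to_fract w" by blast
  show "x + y \<in> range to_fract" unfolding u w by (metis rangeI to_fract_add)
  show "x * y \<in> range to_fract" unfolding u w by (metis rangeI to_fract_mult)
qed

text \<open>\<open>D\<close> plays the role of a multiplicative set of denominators and
  \<open>S\<close> of the integral elements. Multiplying by the denominator of a new element keeps
  the earlier products in \<open>S\<close>.\<close>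

lemma common_multiplier:
  fixes D S :: "'a::comm_monoid_mult set"
  assumes "finite X" "1 \<in> D"
    and "\<And>d e. d \<in> D \<Longrightarrow> e \<in> D \<Longrightarrow> d * e \<in> D"
    and "\<And>d x. d \<in> D \<Longrightarrow> x \<in> S \<Longrightarrow> d * x \<in> S"
    and "\<And>x. x \<in> X \<Longrightarrow> \<exists>d\<in>D. d * x \<in> S"
  shows "\<exists>d\<in>D. \<forall>x\<in>X. d * x \<in> S"
  using assms(1,5)
proof (induction X)
  case empty
  then show ?case using assms(2) by blast
next
  case (insert y X)
  then obtain d e where d: "d \<in> D" "\<forall>x\<in>X. d * x \<in> S" and e: "e \<in> D" "e * y \<in> S"
    by (metis insertCI)
  have "d * e * x \<in> S" if "x \<in> insert y X" for x
  proof (cases "x = y")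
    case True
    then show ?thesis using assms(4)[OF d(1) e(2)] by (simp add: mult.assoc)
  next
    case False
    then have "e * (d * x) \<in> S" using that d e(1) assms(4) by blast
    then show ?thesis by (simp add: ac_simps)
  qed
  then show ?case using assms(3)[OF d(1) e(1)] by blast
qed

text \<open>
  Zero is included even for \<open>c < 0\<close>, where no \<open>m\<close> exists, so that membership in \<open>weighted\<close> also
  forces all exponents to be at least \<open>w\<close>.
\<close>

definition denom_bounded :: "'a::comm_ring_1 set \<Rightarrow> 'a \<Rightarrow> real \<Rightarrow> real \<Rightarrow> 'a set" where
  "denom_bounded R b \<eta> c = {x. x = 0 \<or> (\<exists>m::nat. real m * \<eta> \<le> c \<and> b ^ m * x \<in> R)}"

definition weighted :: "'a::comm_ring_1 set \<Rightarrow> 'a \<Rightarrow> real \<Rightarrow> real \<Rightarrow> 'a gps set" where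
  "weighted R b \<eta> w = {g. \<forall>s. gps_nth g s \<in> denom_bounded R b \<eta> (s - w)}"

lemma denom_bounded_mono: "c \<le> c' \<Longrightarrow> x \<in> denom_bounded R b \<eta> c \<Longrightarrow> x \<in> denom_bounded R b \<eta> c'"
  unfolding denom_bounded_def by (auto intro: order_trans)

lemma denom_bounded_base: "x \<in> R \<Longrightarrow> 0 \<le> c \<Longrightarrow> x \<in> denom_bounded R b \<eta> c"
  unfolding denom_bounded_def by (auto intro!: exI[of _ "0::nat"])

lemma weighted_mono: "w' \<le> w \<Longrightarrow> g \<in> weighted R b \<eta> w \<Longrightarrow> g \<in> weighted R b \<eta> w'"
  unfolding weighted_def by (auto intro: denom_bounded_mono[rotated])

lemma gps_over_subset_weighted: "gps_over R \<subseteq> weighted R b \<eta> 0"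
proof
  fix g assume "g \<in> gps_over R"
  then have "gps_nth g s \<in> denom_bounded R b \<eta> s" for s
    using denom_bounded_base[of "gps_nth g s" R s] gps_nth_nonzero[of g s]
    by (cases "gps_nth g s = 0") (auto simp: gps_over_def denom_bounded_def)
  then show "g \<in> weighted R b \<eta> 0"
    by (simp add: weighted_def)
qed

context subring_set
begin

context
  fixes b :: 'a and \<eta> :: real
  assumes b: "b \<in> R"
begin

text \<open>The larger of the two powers of \<open>b\<close> clears both summands and still obeys
  the bound.\<close>

lemma denom_bounded_add:
  assumes "x \<in> denom_bounded R b \<eta> c" "y \<in> denom_bounded R b \<eta> c"
  shows "x + y \<in> denom_bounded R b \<eta> c"
proof (cases "x = 0 \<or> y = 0")
  case True
  then show ?thesis using assms by auto
next
  case False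
  then obtain m n where m: "real m * \<eta> \<le> c" "b ^ m * x \<in> R" and n: "real n * \<eta> \<le> c" "b ^ n * y \<in> R"
    using assms by (auto simp: denom_bounded_def)
  have "b ^ max m n * x = b ^ (max m n - m) * (b ^ m * x)"
       "b ^ max m n * y = b ^ (max m n - n) * (b ^ n * y)"
    by (simp_all flip: power_add mult.assoc)
  then have "b ^ max m n * (x + y) \<in> R"
    using m n b by (simp add: distrib_left) (metis add_mem mult_mem power_mem)
  moreover have "real (max m n) * \<eta> \<le> c" using m n by (auto simp: max_def)
  ultimately show ?thesis unfolding denom_bounded_def by blast
qed

lemma denom_bounded_mult:
  assumes "x \<in> denom_bounded R b \<eta> c" "y \<in> denom_bounded R b \<eta> d"
  shows "x * y \<in> denom_bounded R b \<eta> (c + d)"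
proof (cases "x = 0 \<or> y = 0")
  case True
  then show ?thesis by (auto simp: denom_bounded_def)
next
  case False
  then obtain m n where m: "real m * \<eta> \<le> c" "b ^ m * x \<in> R" and n: "real n * \<eta> \<le> d" "b ^ n * y \<in> R"
    using assms by (auto simp: denom_bounded_def)
  have "b ^ (m + n) * (x * y) \<in> R"
    using mult_mem[OF m(2) n(2)] by (simp add: power_add ac_simps)
  moreover have "real (m + n) * \<eta> \<le> c + d" using m n by (simp add: distrib_right)
  ultimately show ?thesis unfolding denom_bounded_def by blast
qed

lemma denom_bounded_sum:
  "(\<And>i. i \<in> I \<Longrightarrow> x i \<in> denom_bounded R b \<eta> c) \<Longrightarrow> sum x I \<in> denom_bounded R b \<eta> c"
proof (induction I rule: infinite_finite_induct)
  case (insert i I)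
  then show ?case by (simp add: denom_bounded_add)
qed (simp_all add: denom_bounded_def)

lemma weighted_add: "g \<in> weighted R b \<eta> w \<Longrightarrow> h \<in> weighted R b \<eta> w \<Longrightarrow> g + h \<in> weighted R b \<eta> w"
  by (auto simp: weighted_def intro: denom_bounded_add)

text \<open>The bound is linear in the exponent, so the allowances at \<open>t\<close> and
  \<open>u\<close> add up to the one at \<open>t + u\<close> with the weights summed. A bound on the
  mere number of recursion steps would not add up like this.\<close>

lemma weighted_mult:
  assumes "g \<in> weighted R b \<eta> w" "h \<in> weighted R b \<eta> w'"
  shows "g * h \<in> weighted R b \<eta> (w + w')"
proof -
  have "gps_nth g t * gps_nth h u \<in> denom_bounded R b \<eta> (t + u - (w + w'))" for t u
    using denom_bounded_mult[of "gps_nth g t" "t - w" "gps_nth h u" "u - w'"] assms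
    by (simp add: weighted_def algebra_simps)
  then show ?thesis
    by (auto simp: weighted_def gps_nth_mult intro!: denom_bounded_sum)
qed

lemma poly_weighted:
  assumes "\<And>i. coeff p i \<in> gps_over R" "g \<in> weighted R b \<eta> 0"
  shows "poly p g \<in> weighted R b \<eta> 0"
  using assms(1)
proof (induction p)
  case 0
  then show ?case by (simp add: weighted_def denom_bounded_def)
next
  case (pCons a p)
  have a: "a \<in> gps_over R" using pCons.prems[of 0] by simp
  have p: "coeff p j \<in> gps_over R" for j using pCons.prems[of "Suc j"] by simp
  have "a \<in> weighted R b \<eta> 0" using a gps_over_subset_weighted by blast
  then show ?case
    using weighted_add weighted_mult[OF assms(2) pCons.IH[OF p]] by simp
qed

end

text \<open>For \<open>b = 1\<close> and slope 0, weight 0 means integral coefficients, so closure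
  under products is a case of \<open>weighted_mult\<close>.\<close>

lemma subring_set_gps_over: "subring_set (gps_over R)"
proof -
  have "gps_nth g s \<in> R \<longleftrightarrow> gps_nth g s \<in> denom_bounded R 1 0 s" for g s
    using gps_nth_nonzero[of g s] by (auto simp: denom_bounded_def zero_mem)
  then have eq: "gps_over R = weighted R 1 0 0"
    by (simp add: gps_over_def weighted_def)
  show ?thesis
  proof
    fix x y :: "'a gps"
    assume x: "x \<in> gps_over R"
    then show "- x \<in> gps_over R" by (auto simp: gps_over_def uminus_mem)
    assume y: "y \<in> gps_over R"
    from x y show "x + y \<in> gps_over R" by (auto simp: gps_over_def add_mem)
    from x y show "x * y \<in> gps_over R"
      unfolding eq using weighted_mult[OF one_mem, of x 0 0 y 0] by simp
  qed (auto simp: gps_over_def gps_nth_1 one_mem zero_mem)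
qed

end

section \<open>Orders of series\<close>

definition order_ge :: "real \<Rightarrow> 'a::zero gps set" where
  "order_ge r = {g. \<forall>s<r. gps_nth g s = 0}"

lemma order_ge_0: "g \<in> order_ge 0"
  by (auto simp: order_ge_def gps_nth_neg)

lemma order_ge_mono: "r' \<le> r \<Longrightarrow> g \<in> order_ge r \<Longrightarrow> g \<in> order_ge r'"
  by (auto simp: order_ge_def)

lemma order_ge_add: "g \<in> order_ge r \<Longrightarrow> h \<in> order_ge r \<Longrightarrow> g + h \<in> order_ge r"
  for g h :: "'a::ab_group_add gps"
  by (auto simp: order_ge_def)

text \<open>With \<open>R = UNIV\<close> integrality is automatic, and \<open>weighted\<close>
  retains only the condition that no exponent lies below the weight.\<close>

lemma order_ge_mult:
  fixes g h :: "'a::comm_ring_1 gps"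
  assumes "g \<in> order_ge r" "h \<in> order_ge q"
  shows "g * h \<in> order_ge (r + q)"
proof -
  interpret subring_set "UNIV :: 'a set" by (rule subring_set_UNIV)
  have eq: "order_ge w = weighted (UNIV :: 'a set) 1 0 w" for w
    by (force simp: order_ge_def weighted_def denom_bounded_def)
  show ?thesis using weighted_mult[OF UNIV_I, of g 1 0 r h q] assms unfolding eq by simp
qed

lemma gps_nth_mult_lowest:
  fixes g h :: "'a::comm_ring_1 gps"
  assumes "g \<in> order_ge r" "h \<in> order_ge q"
  shows "gps_nth (g * h) (r + q) = gps_nth g r * gps_nth h q"
proof -
  have "gps_nth (g * h) (r + q) = (\<Sum>(t, u)\<in>{(r, q)}. gps_nth g t * gps_nth h u)"
    unfolding gps_nth_mult
  proof (rule sum.mono_neutral_left)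
    show "{(t, u). t + u = r + q \<and> gps_nth g t \<noteq> 0 \<and> gps_nth h u \<noteq> 0} \<subseteq> {(r, q)}"
      using assms by (auto simp: order_ge_def) (smt (verit))+
  qed auto
  then show ?thesis by simp
qed

text \<open>Only finitely many exponents lie in the interval from \<open>v\<close> to
  \<open>v + 1\<close>. Adding \<open>v + 1\<close> itself makes the minimum exist and caps \<eta>
  at 1.\<close>

lemma gps_support_gap:
  obtains \<eta> where "0 < \<eta>" "\<eta> \<le> 1" "\<And>t. v < t \<Longrightarrow> t < v + \<eta> \<Longrightarrow> gps_nth f t = 0"
proof -
  let ?S = "insert (v + 1) {t. v < t \<and> gps_nth f t \<noteq> 0 \<and> t \<le> v + 1}"
  have fin: "finite ?S"
    using finite_subset[OF _ gps_finite[of f "v + 1"], of "{t. v < t \<and> gps_nth f t \<noteq> 0 \<and> t \<le> v + 1}"]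
    by auto
  have "Min ?S \<in> ?S" by (rule Min_in[OF fin]) auto
  moreover have "Min ?S \<le> v + 1" by (rule Min_le[OF fin]) auto
  moreover have "gps_nth f t = 0" if "v < t" "t < Min ?S" for t
    using Min_le[OF fin, of t] that \<open>Min ?S \<le> v + 1\<close> by force
  ultimately show ?thesis by (intro that[of "Min ?S - v"]) auto
qed

section \<open>Truncations and constant series\<close>

lift_definition gps_trunc :: "real \<Rightarrow> 'a::zero gps \<Rightarrow> 'a gps" is
  "\<lambda>r a s. if s < r then a s else 0"
  by (auto intro: finite_subset[rotated])

lemma gps_nth_trunc: "gps_nth (gps_trunc r f) s = (if s < r then gps_nth f s else 0)"
  by transfer simp

lift_definition gps_const :: "'a::zero \<Rightarrow> 'a gps" is "\<lambda>c s. if s = 0 then c else 0"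
proof -
  fix c :: 'a
  have "finite {s :: real. (if s = 0 then c else 0) \<noteq> 0 \<and> s \<le> r}" for r
    by (rule finite_subset[of _ "{0}"]) auto
  then show "(\<forall>s::real<0. (if s = 0 then c else 0) = 0) \<and>
      (\<forall>r. finite {s :: real. (if s = 0 then c else 0) \<noteq> 0 \<and> s \<le> r})"
    by auto
qed

lemma gps_nth_const: "gps_nth (gps_const c) s = (if s = 0 then c else 0)"
  by transfer simp

lemma gps_nth_const_mult: "gps_nth (gps_const c * f) s = c * gps_nth f s"
  for f :: "'a::comm_ring_1 gps"
proof -
  have "gps_nth (gps_const c * f) s = (\<Sum>t\<in>{0}. \<Sum>u\<in>insert s {u. gps_nth f u \<noteq> 0 \<and> u \<le> s}.
      if t + u = s then gps_nth (gps_const c) t * gps_nth f u else 0)"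
    by (rule gps_nth_mult_superset) (auto simp: gps_nth_const gps_finite split: if_splits)
  then show ?thesis by (simp add: gps_nth_const gps_finite)
qed

lemma gps_nth_diff: "gps_nth (f - g) s = gps_nth f s - gps_nth g s"
  for f g :: "'a::ab_group_add gps"
  using gps_nth_add[of f "- g" s] by simp

section \<open>First-order expansion of polynomials\<close>

lemma poly_eq_const_plus: "\<exists>u. poly p x = coeff p 0 + x * u"
proof (cases p)
  case (pCons a q)
  then have "poly p x = coeff p 0 + x * poly q x" by simp
  then show ?thesis by blast
qed

text \<open>Taylor expansion to first order in \<open>y\<close>, with \<open>coeff p 1\<close> split
  off from the factor of \<open>y\<close>: when \<open>x\<close> and \<open>y\<close> have high
  order, the rest of that factor is negligible.\<close>

lemma poly_add_eq:
  fixes p :: "'a::comm_ring_1 poly"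
  shows "\<exists>u w. poly p (x + y) = poly p x + y * (coeff p 1 + x * u + y * w)"
proof (induction p)
  case 0
  have "poly 0 (x + y) = poly 0 x + y * (coeff 0 1 + x * 0 + y * 0)" by simp
  then show ?case by blast
next
  case (pCons a p)
  obtain u w where uw: "poly p (x + y) = poly p x + y * (coeff p 1 + x * u + y * w)"
    using pCons.IH by blast
  obtain z where z: "poly p x = coeff p 0 + x * z" using poly_eq_const_plus by blast
  define E where "E = coeff p 1 + x * u + y * w"
  have uw': "poly p (x + y) = poly p x + y * E" using uw by (simp only: E_def)
  have "a + (x + y) * (c + x * z + y * E) = a + x * (c + x * z) + y * (c + x * (z + E) + y * E)" for c
    by (simp add: algebra_simps)
  from this[of "coeff p 0"]
  have "poly (pCons a p) (x + y) = poly (pCons a p) x + y * (coeff (pCons a p) 1 + x * (z + E) + y * E)"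
    by (simp only: poly_pCons uw' z[symmetric] One_nat_def coeff_pCons_Suc)
  then show ?case by blast
qed

section \<open>The recursion for the coefficients of a root\<close>

text \<open>At the least exponent \<open>s\<close> violating the bound, the coefficient of
  \<open>poly Q h\<close> at \<open>s + v\<close> isolates \<open>b\<close> times that of
  \<open>h\<close> at \<open>s\<close>. All other terms there have allowance
  \<open>s + v - 2 * \<delta>\<close>, which is \<open>s - \<delta>\<close> less one \<eta>: exactly
  room for one more factor \<open>b\<close>.\<close>

lemma (in subring_set) root_weighted:
  fixes h :: "'a gps"
  assumes Q: "\<And>i. coeff Q i \<in> gps_over R" and root: "poly Q h = 0"
    and q1: "coeff Q 1 \<in> order_ge v" "\<And>t. v < t \<Longrightarrow> t < v + \<eta> \<Longrightarrow> gps_nth (coeff Q 1) t = 0"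
    and \<eta>: "0 < \<eta>" "\<eta> \<le> 1" and v: "0 \<le> v" and h: "h \<in> order_ge (v + 2)"
  shows "h \<in> weighted R (gps_nth (coeff Q 1) v) \<eta> (v + \<eta>)"
proof -
  define b where "b = gps_nth (coeff Q 1) v"
  define \<delta> where "\<delta> = v + \<eta>"
  let ?B = "denom_bounded R b \<eta>"
  have b: "b \<in> R" using Q[of 1] by (simp add: gps_over_def b_def)
  have "gps_nth h r \<in> ?B (r - \<delta>)" for r
  proof (rule ccontr)
    assume r: "gps_nth h r \<notin> ?B (r - \<delta>)"
    \<comment> \<open>Zero always satisfies the bound, so violations lie in the support of
      \<open>h\<close>; cut off at \<open>r\<close> they are finite in number and have a
      minimum.\<close>
    let ?S = "{s. gps_nth h s \<notin> ?B (s - \<delta>) \<and> s \<le> r}"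
    have fin: "finite ?S"
      by (rule finite_subset[OF _ gps_finite[of h r]]) (auto simp: denom_bounded_def)
    define s where "s = Min ?S"
    have s: "gps_nth h s \<notin> ?B (s - \<delta>)" "s \<le> r"
      using Min_in[OF fin] r unfolding s_def by blast+
    have less_s: "gps_nth h t \<in> ?B (t - \<delta>)" if "t < s" for t
      using Min_le[OF fin, of t] that s(2) unfolding s_def by force
    have s_ge: "v + 2 \<le> s" using s(1) h by (force simp: order_ge_def denom_bounded_def)
    \<comment> \<open>\<open>g\<close> is the part of \<open>h\<close> that minimality of
      \<open>s\<close> already controls; the remainder \<open>k\<close> begins at \<open>s\<close>
      with the coefficient of \<open>h\<close>.\<close>
    define g where "g = gps_trunc s h"
    define k where "k = h - g"
    have g: "g \<in> weighted R b \<eta> \<delta>"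
      using less_s by (auto simp: weighted_def g_def gps_nth_trunc denom_bounded_def)
    have k: "k \<in> order_ge s" by (auto simp: order_ge_def k_def gps_nth_diff g_def gps_nth_trunc)
    have g_ord: "g \<in> order_ge (v + 2)" using h by (auto simp: order_ge_def g_def gps_nth_trunc)
    obtain u w where uw: "poly Q (g + k) = poly Q g + k * (coeff Q 1 + g * u + k * w)"
      using poly_add_eq by blast
    define e where "e = g * u + k * w"
    \<comment> \<open>Both \<open>g\<close> and \<open>k\<close> have order at least
      \<open>v + 2\<close>, so \<open>e\<close> does not disturb the coefficient \<open>b\<close> at
      \<open>v\<close>.\<close>
    have "e \<in> order_ge (v + 2)"
      using order_ge_mult[OF g_ord order_ge_0, of u]
        order_ge_mult[OF order_ge_mono[OF s_ge k] order_ge_0, of w]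
      by (simp add: e_def order_ge_add)
    then have e: "e \<in> order_ge v" "gps_nth e v = 0" by (auto simp: order_ge_def)
    have "0 = gps_nth (poly Q g + k * (coeff Q 1 + e)) (s + v)"
      using root uw by (simp add: k_def e_def add.assoc)
    also have "\<dots> = gps_nth (poly Q g) (s + v) + gps_nth h s * b"
      using gps_nth_mult_lowest[OF k order_ge_add[OF q1(1) e(1)]] e(2)
      by (simp add: b_def k_def gps_nth_diff g_def gps_nth_trunc)
    finally have bh: "gps_nth (poly Q g) (s + v) = - (b * gps_nth h s)"
      by (simp add: eq_neg_iff_add_eq_0 mult.commute)

    \<comment> \<open>Constant, linear and higher terms of \<open>poly Q g\<close> are estimated
      separately; the higher ones contain \<open>g * g\<close> and so have weight
      \<open>2 * \<delta>\<close>.\<close>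
    obtain q0 q1 Q2 where Q_eq: "Q = pCons q0 (pCons q1 Q2)"
      by (metis pCons_cases)
    have q0: "q0 \<in> gps_over R" using Q[of 0] by (simp add: Q_eq)
    have Q2: "coeff Q2 i \<in> gps_over R" for i using Q[of "Suc (Suc i)"] by (simp add: Q_eq)
    have "\<delta> \<ge> 0" using v \<eta> by (simp add: \<delta>_def)
    have "g * g * poly Q2 g \<in> weighted R b \<eta> (\<delta> + \<delta> + 0)"
      by (intro weighted_mult[OF b] poly_weighted[OF b] g Q2 weighted_mono[OF \<open>\<delta> \<ge> 0\<close>])
    then have t2: "gps_nth (g * g * poly Q2 g) (s + v) \<in> ?B (s + v - 2 * \<delta>)"
      by (auto simp: weighted_def)
    \<comment> \<open>Since \<open>g\<close> stops before \<open>s\<close>, its partner exponent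
      \<open>t\<close> exceeds \<open>v\<close>, and the gap forces \<open>\<delta> \<le> t\<close>.
      The integral coefficient at \<open>t\<close> thus supplies the second \<delta>.\<close>
    have t1: "gps_nth (coeff Q 1 * g) (s + v) \<in> ?B (s + v - 2 * \<delta>)"
      unfolding gps_nth_mult
    proof (rule denom_bounded_sum[OF b], clarify)
      fix t u assume tu: "t + u = s + v" "gps_nth (coeff Q 1) t \<noteq> 0" "gps_nth g u \<noteq> 0"
      have "u < s" using tu(3) by (auto simp: g_def gps_nth_trunc split: if_splits)
      then have "\<delta> \<le> t" using q1(2)[of t] tu by (force simp: \<delta>_def)
      then have "gps_nth (coeff Q 1) t \<in> ?B (t - \<delta>)"
        using Q[of 1] by (auto simp: gps_over_def intro: denom_bounded_base)
      moreover have "gps_nth g u \<in> ?B (u - \<delta>)" using g by (simp add: weighted_def)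
      ultimately have "gps_nth (coeff Q 1) t * gps_nth g u \<in> ?B (t - \<delta> + (u - \<delta>))"
        by (rule denom_bounded_mult[OF b])
      moreover have "t - \<delta> + (u - \<delta>) = s + v - 2 * \<delta>" using tu(1) by simp
      ultimately show "gps_nth (coeff Q 1) t * gps_nth g u \<in> ?B (s + v - 2 * \<delta>)"
        by (simp only:)
    qed
    \<comment> \<open>No factor \<open>b\<close> is required: \<open>s \<ge> v + 2\<close> and
      \<open>\<eta> \<le> 1\<close> make the allowance at least
      \<open>2 - 2 * \<eta> \<ge> 0\<close>.\<close>
    have t0: "gps_nth q0 (s + v) \<in> ?B (s + v - 2 * \<delta>)"
      using q0 s_ge \<eta> by (auto simp: gps_over_def \<delta>_def intro: denom_bounded_base)
    have "poly Q g = q0 + (coeff Q 1 * g + g * g * poly Q2 g)"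
      by (simp add: Q_eq algebra_simps)
    then have "gps_nth (poly Q g) (s + v) \<in> ?B (s + v - 2 * \<delta>)"
      using denom_bounded_add[OF b t0 denom_bounded_add[OF b t1 t2]] by simp
    then consider "- (b * gps_nth h s) = 0"
      | m :: nat where "real m * \<eta> \<le> s + v - 2 * \<delta>" "b ^ m * - (b * gps_nth h s) \<in> R"
      unfolding bh denom_bounded_def by blast
    then have "gps_nth h s \<in> ?B (s - \<delta>)"
    proof cases
      \<comment> \<open>The ring may have zero divisors, so \<open>h\<close> need not vanish at
        \<open>s\<close>; one factor \<open>b\<close> kills the coefficient, and
        \<open>s - \<delta>\<close> is at least \<eta>.\<close>
      case 1
      then have "b ^ 1 * gps_nth h s \<in> R" using zero_mem by simp
      moreover have "real 1 * \<eta> \<le> s - \<delta>" using s_ge \<eta> by (simp add: \<delta>_def)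
      ultimately show ?thesis unfolding denom_bounded_def by blast
    next
      case 2
      from uminus_mem[OF 2(2)] have "b ^ Suc m * gps_nth h s \<in> R" by (simp add: ac_simps)
      moreover have "real (Suc m) * \<eta> \<le> s - \<delta>" using 2(1) by (simp add: \<delta>_def algebra_simps)
      ultimately show ?thesis unfolding denom_bounded_def by blast
    qed
    with s(1) show False by blast
  qed
  then show ?thesis unfolding weighted_def b_def \<delta>_def by blast
qed

section \<open>Clearing denominators\<close>

lemma fract_poly_exists:
  fixes p :: "'a::idom fract poly"
  assumes "\<And>i. coeff p i \<in> to_fract ` S" "0 \<in> S"
  shows "\<exists>P. (\<forall>i. coeff P i \<in> S) \<and> p = fract_poly P"
  using assms(1)
proof (induction p)
  case 0
  have "(\<forall>i. coeff (0 :: 'a poly) i \<in> S) \<and> (0 :: 'a fract poly) = fract_poly 0"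
    using assms(2) by simp
  then show ?case by blast
next
  case (pCons a p)
  obtain c where c: "c \<in> S" "a = to_fract c" using pCons.prems[of 0] by auto
  have p: "coeff p j \<in> to_fract ` S" for j using pCons.prems[of "Suc j"] by simp
  obtain P where P: "\<forall>i. coeff P i \<in> S" "p = fract_poly P"
    using pCons.IH[OF p] by blast
  have "coeff (pCons c P) i \<in> S" for i using c P by (cases i) auto
  moreover have "pCons a p = fract_poly (pCons c P)"
    using c P by (simp add: map_poly_pCons)
  ultimately show ?case by blast
qed

lemma poly_fract_poly: "poly (fract_poly p) (to_fract x) = to_fract (poly p x)"
  by (induction p) (simp_all add: map_poly_pCons)

lemma pderiv_fract_poly: "pderiv (fract_poly p) = fract_poly (pderiv p)"
  by (induction p) (simp_all add: map_poly_pCons pderiv_pCons)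

text \<open>A common root of \<open>p\<close> and \<open>pderiv p\<close> would give a common linear
  factor, against coprimality. Clearing denominators only scales both values by a nonzero
  \<open>d\<close>.\<close>

lemma separable_root_exists_poly:
  fixes \<alpha> :: "'a::idom"
  assumes "subring_set S" and "separable_over (fraction_field_of S) (to_fract \<alpha>)"
  obtains P where "\<And>i. coeff P i \<in> S" "poly P \<alpha> = 0" "poly (pderiv P) \<alpha> \<noteq> 0"
proof -
  interpret subring_set S by fact
  obtain p where p: "p \<in> polys_over (fraction_field_of S)" "poly p (to_fract \<alpha>) = 0" "coprime p (pderiv p)"
    using assms(2) unfolding separable_over_def is_minimal_poly_def separable_poly_def by blast
  have p': "poly (pderiv p) (to_fract \<alpha>) \<noteq> 0"
  proof
    assume "poly (pderiv p) (to_fract \<alpha>) = 0"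
    then have "is_unit [:- to_fract \<alpha>, 1:]"
      using p(2) coprime_common_divisor[OF p(3)] unfolding poly_eq_0_iff_dvd by blast
    then show False by (simp add: is_unit_pCons_iff)
  qed
  let ?D = "to_fract ` (S - {0})"
  have "\<exists>d\<in>?D. d * x \<in> to_fract ` S" if x: "x \<in> set (coeffs p)" for x
  proof -
    obtain m n where mn: "x = Fract m n" "m \<in> S" "n \<in> S" "n \<noteq> 0"
      using p(1) x unfolding polys_over_def fraction_field_of_def by blast
    then have "to_fract n * x = to_fract m" by (simp add: Fract_conv_to_fract)
    with mn show ?thesis by blast
  qed
  moreover have "1 \<in> ?D" using one_mem by (force simp flip: to_fract_1)
  moreover have "d * e \<in> ?D" if "d \<in> ?D" "e \<in> ?D" for d e
    using that mult_mem by (force simp flip: to_fract_mult)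
  moreover have "d * x \<in> to_fract ` S" if "d \<in> ?D" "x \<in> to_fract ` S" for d x
    using that mult_mem by (force simp flip: to_fract_mult)
  ultimately have "\<exists>d\<in>?D. \<forall>x\<in>set (coeffs p). d * x \<in> to_fract ` S"
    by (intro common_multiplier) auto
  then obtain d where d: "d \<in> ?D" "\<And>x. x \<in> set (coeffs p) \<Longrightarrow> d * x \<in> to_fract ` S" by blast
  have "coeff (smult d p) i \<in> to_fract ` S" for i
  proof (cases "coeff p i = 0")
    case True
    then show ?thesis using zero_mem by (metis coeff_smult imageI mult_zero_right to_fract_0)
  next
    case False
    then have "coeff p i \<in> set (coeffs p)" by (metis coeff_0 coeff_in_coeffs le_degree)
    then show ?thesis using d(2) by simp
  qed
  then obtain P where P: "\<forall>i. coeff P i \<in> S" "smult d p = fract_poly P"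
    using fract_poly_exists zero_mem by blast
  have "to_fract (poly P \<alpha>) = d * poly p (to_fract \<alpha>)"
    by (simp flip: poly_fract_poly P(2))
  moreover have "to_fract (poly (pderiv P) \<alpha>) = d * poly (pderiv p) (to_fract \<alpha>)"
    by (simp flip: poly_fract_poly pderiv_fract_poly P(2) add: pderiv_smult)
  moreover have "d \<noteq> 0" using d(1) by auto
  ultimately have "to_fract (poly P \<alpha>) = 0" "to_fract (poly (pderiv P) \<alpha>) \<noteq> 0"
    using p(2) p' by simp_all
  then show ?thesis using that[of P] P(1) by simp
qed

text \<open>One constant must clear all coefficients at once, which a series over the fraction field
  need not allow.\<close>

definition gps_common_denom :: "'a::comm_ring_1 set \<Rightarrow> 'a gps set" where
  "gps_common_denom R = {g. \<exists>d\<in>R - {0}. gps_const d * g \<in> gps_over R}"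

lemma gps_const_mult: "gps_const (c * d) = gps_const c * gps_const d"
  for c :: "'a::comm_ring_1"
  by (rule gps_eqI) (simp add: gps_nth_const_mult gps_nth_const)

lemma gps_const_1: "gps_const 1 = 1"
  by (rule gps_eqI) (simp add: gps_nth_const gps_nth_1)

lemma (in subring_set) gps_const_mem: "c \<in> R \<Longrightarrow> gps_const c \<in> gps_over R"
  by (simp add: gps_over_def gps_nth_const zero_mem)

lemma subring_set_gps_common_denom:
  fixes R :: "'a::idom set"
  assumes "subring_set R"
  shows "subring_set (gps_common_denom R)"
proof -
  interpret subring_set R by fact
  interpret S: subring_set "gps_over R" by (rule subring_set_gps_over)
  show ?thesis
  proof
    show "1 \<in> gps_common_denom R"
      using one_mem by (auto simp: gps_common_denom_def gps_const_1 S.one_mem intro!: bexI[of _ 1])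
    fix x y assume "x \<in> gps_common_denom R"
    then obtain d where d: "d \<in> R - {0}" "gps_const d * x \<in> gps_over R"
      by (auto simp: gps_common_denom_def)
    then show "- x \<in> gps_common_denom R"
      using S.uminus_mem by (force simp: gps_common_denom_def)
    assume "y \<in> gps_common_denom R"
    then obtain e where e: "e \<in> R - {0}" "gps_const e * y \<in> gps_over R"
      by (auto simp: gps_common_denom_def)
    have de: "d * e \<in> R - {0}" using d e by (auto simp: mult_mem)
    have "gps_const e * (gps_const d * x) + gps_const d * (gps_const e * y) \<in> gps_over R"
      using d e by (auto intro!: S.add_mem S.mult_mem gps_const_mem)
    then have "gps_const (d * e) * (x + y) \<in> gps_over R"
      by (simp add: gps_const_mult algebra_simps)
    with de show "x + y \<in> gps_common_denom R" unfolding gps_common_denom_def by blast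
    have "gps_const (d * e) * (x * y) \<in> gps_over R"
      using S.mult_mem[OF d(2) e(2)] by (simp add: gps_const_mult ac_simps)
    with de show "x * y \<in> gps_common_denom R" unfolding gps_common_denom_def by blast
  qed
qed

text \<open>A truncation has only finitely many nonzero coefficients, so their denominators have a
  common multiple.\<close>

lemma gps_trunc_common_denom:
  fixes f :: "'a::idom fract gps"
  shows "gps_trunc r f \<in> gps_common_denom (range to_fract)"
proof -
  let ?R = "range (to_fract :: 'a \<Rightarrow> _)"
  interpret subring_set ?R by (rule subring_set_range_to_fract)
  have den: "\<exists>d\<in>?R - {0}. d * x \<in> ?R" for x
  proof (cases x)
    case (Fract m n)
    then have "to_fract n * x = to_fract m" "to_fract n \<noteq> 0" by (simp_all add: Fract_conv_to_fract)
    then show ?thesis by blast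
  qed
  have "\<exists>d\<in>?R - {0}. \<forall>x\<in>gps_nth f ` {s. gps_nth f s \<noteq> 0 \<and> s \<le> r}. d * x \<in> ?R"
  proof (intro common_multiplier)
    show "1 \<in> ?R - {0}" using one_mem by simp
    show "d * e \<in> ?R - {0}" if "d \<in> ?R - {0}" "e \<in> ?R - {0}" for d e
      using that mult_mem[of d e] by simp
    show "d * x \<in> ?R" if "d \<in> ?R - {0}" "x \<in> ?R" for d x
      using that mult_mem[of d x] by simp
  qed (use den in \<open>simp_all add: gps_finite\<close>)
  then obtain d where d: "d \<in> ?R - {0}" "\<And>s. gps_nth f s \<noteq> 0 \<Longrightarrow> s \<le> r \<Longrightarrow> d * gps_nth f s \<in> ?R"
    by blast
  have "d * gps_nth (gps_trunc r f) s \<in> ?R" for s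
    using d(2)[of s] zero_mem by (cases "gps_nth f s = 0") (auto simp: gps_nth_trunc)
  with d(1) show ?thesis
    by (auto simp: gps_common_denom_def gps_over_def gps_nth_const_mult)
qed

section \<open>Assembling the bound for a separable series\<close>

theorem mainTheorem1:
  fixes f :: "'a::idom fract gps"
  assumes "algebraic_over (fraction_field_of (gps_over (range (to_fract :: 'a \<Rightarrow> 'a fract)))) (to_fract f)"
    and "separable_over (fraction_field_of (gps_over (range (to_fract :: 'a \<Rightarrow> 'a fract)))) (to_fract f)"
  shows "\<exists>a::'a. a \<noteq> 0 \<and>
           (\<forall>s\<ge>0. to_fract a ^ (nat \<lceil>s\<rceil> + 1) * gps_nth f s \<in> range (to_fract :: 'a \<Rightarrow> 'a fract))"
proof -
  let ?R = "range (to_fract :: 'a \<Rightarrow> 'a fract)"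
  interpret R: subring_set ?R by (rule subring_set_range_to_fract)
  interpret S: subring_set "gps_over ?R" by (rule R.subring_set_gps_over)
  interpret S': subring_set "gps_common_denom ?R"
    by (rule subring_set_gps_common_denom[OF subring_set_range_to_fract])
  obtain P where P: "\<And>i. coeff P i \<in> gps_over ?R" "poly P f = 0" "poly (pderiv P) f \<noteq> 0"
    using separable_root_exists_poly[OF R.subring_set_gps_over assms(2)] by blast
  obtain v where v: "gps_nth (poly (pderiv P) f) v \<noteq> 0"
      "\<And>t. gps_nth (poly (pderiv P) f) t \<noteq> 0 \<Longrightarrow> v \<le> t"
    using gps_order_exists[OF P(3)] by blast
  have v0: "0 \<le> v" using v(1) by (rule gps_nth_nonzero)
  \<comment> \<open>The cutoff \<open>v + 2\<close> puts the order of \<open>h\<close> above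
    \<open>v\<close> and also gives \<open>root_weighted\<close> its margin.\<close>
  define f0 where "f0 = gps_trunc (v + 2) f"
  define h where "h = f - f0"
  have h: "h \<in> order_ge (v + 2)"
    by (auto simp: order_ge_def h_def f0_def gps_nth_diff gps_nth_trunc)
  have f0: "f0 \<in> gps_common_denom ?R" unfolding f0_def by (rule gps_trunc_common_denom)
  define Q where "Q = pcompose P [:f0, 1:]"
  have over: "g \<in> gps_common_denom ?R" if "g \<in> gps_over ?R" for g
    using that R.one_mem by (auto simp: gps_common_denom_def gps_const_1 intro!: bexI[of _ 1])
  have Q_mem: "coeff Q i \<in> gps_common_denom ?R" for i
    unfolding Q_def by (intro S'.coeff_pcompose_shift_mem over P(1) f0)
  let ?D = "gps_const ` (?R - {0})"
  \<comment> \<open>\<open>f0\<close> is cleared along with \<open>Q\<close>, because its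
    coefficients return in \<open>f = f0 + h\<close>.\<close>
  have "\<exists>c\<in>?D. \<forall>x\<in>insert f0 (set (coeffs Q)). c * x \<in> gps_over ?R"
  proof (rule common_multiplier)
    show "1 \<in> ?D" using R.one_mem gps_const_1 by (metis DiffI imageI singletonD zero_neq_one)
    show "c * e \<in> ?D" if ce: "c \<in> ?D" "e \<in> ?D" for c e
    proof -
      obtain c' e' where ce: "c = gps_const c'" "e = gps_const e'" "c' \<in> ?R - {0}" "e' \<in> ?R - {0}"
        using ce by blast
      then have "c' * e' \<in> ?R - {0}" using R.mult_mem[of c' e'] by simp
      then show ?thesis using ce by (metis gps_const_mult imageI)
    qed
    show "c * x \<in> gps_over ?R" if "c \<in> ?D" "x \<in> gps_over ?R" for c x
      using that by (auto intro!: S.mult_mem R.gps_const_mem)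
    have "x \<in> gps_common_denom ?R" if x: "x \<in> insert f0 (set (coeffs Q))" for x
    proof (cases "x = f0")
      case True
      then show ?thesis using f0 by simp
    next
      case False
      then obtain i where "x = coeff Q i" using x by (auto simp: coeffs_def split: if_splits)
      then show ?thesis using Q_mem by simp
    qed
    then show "\<exists>c\<in>?D. c * x \<in> gps_over ?R" if "x \<in> insert f0 (set (coeffs Q))" for x
      using that unfolding gps_common_denom_def by blast
  qed auto
  then obtain c where c: "c \<in> ?R" "c \<noteq> 0" "gps_const c * f0 \<in> gps_over ?R"
      "\<And>x. x \<in> set (coeffs Q) \<Longrightarrow> gps_const c * x \<in> gps_over ?R"
    by blast
  define Q' where "Q' = smult (gps_const c) Q"
  have Q': "coeff Q' i \<in> gps_over ?R" for i
  proof (cases "coeff Q i = 0")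
    case False
    then have "coeff Q i \<in> set (coeffs Q)"
      by (metis coeff_0 coeff_in_coeffs le_degree)
    then show ?thesis by (simp add: Q'_def c(4))
  qed (simp add: Q'_def S.zero_mem)
  have root: "poly Q' h = 0"
    using P(2) by (simp add: Q'_def Q_def poly_pcompose h_def)
  \<comment> \<open>By the chain rule the derivative of \<open>Q\<close> at \<open>h\<close> is that
    of \<open>P\<close> at \<open>f\<close>. It differs from \<open>coeff Q 1\<close> by a multiple
    of \<open>h\<close>, so both agree up to exponent \<open>v\<close>; hence
    \<open>b \<noteq> 0\<close>.\<close>
  have "poly (pderiv Q) h = poly (pderiv P) f"
    by (simp add: Q_def pderiv_pcompose poly_pcompose h_def pderiv_pCons)
  moreover obtain u where "poly (pderiv Q) h = coeff (pderiv Q) 0 + h * u"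
    using poly_eq_const_plus by blast
  ultimately have "poly (pderiv P) f = coeff Q 1 + h * u" by (simp add: coeff_pderiv)
  moreover have "gps_nth (h * u) t = 0" if "t \<le> v" for t
    using order_ge_mult[OF h order_ge_0, of u] that by (simp add: order_ge_def)
  ultimately have Q1: "gps_nth (coeff Q 1) t = gps_nth (poly (pderiv P) f) t" if "t \<le> v" for t
    using that by simp
  define b where "b = gps_nth (coeff Q' 1) v"
  have b_eq: "b = c * gps_nth (coeff Q 1) v" by (simp add: b_def Q'_def gps_nth_const_mult)
  have "b \<noteq> 0" using c(2) Q1[of v] v(1) by (simp add: b_eq)
  have b: "b \<in> ?R" using Q'[of 1] by (auto simp: b_def gps_over_def)
  have Q'1: "coeff Q' 1 \<in> order_ge v"
    using Q1 v(2) by (force simp: order_ge_def Q'_def gps_nth_const_mult)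
  obtain \<eta> where \<eta>: "0 < \<eta>" "\<eta> \<le> 1"
      "\<And>t. v < t \<Longrightarrow> t < v + \<eta> \<Longrightarrow> gps_nth (coeff Q' 1) t = 0"
    using gps_support_gap by blast
  have hw: "h \<in> weighted ?R b \<eta> (v + \<eta>)"
    unfolding b_def using R.root_weighted[OF Q' root Q'1 \<eta>(3,1,2) v0 h] .
  \<comment> \<open>\<open>M\<close> turns the slope into an integer: for \<open>s \<le> j\<close>,
    the at most \<open>s / \<eta>\<close> factors \<open>b\<close> are covered by
    \<open>M * j\<close>.\<close>
  define M where "M = nat \<lceil>1 / \<eta>\<rceil>"
  have M: "1 \<le> real M * \<eta>"
    using mult_right_mono[OF real_nat_ceiling_ge[of "1 / \<eta>"], of \<eta>] \<eta>(1)
    by (simp add: M_def del: of_nat_nat)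
  have hs: "b ^ (M * j) * gps_nth h s \<in> ?R" if "s \<le> real j" for s j
  proof (cases "gps_nth h s = 0")
    case True
    then show ?thesis using R.zero_mem by (simp only: mult_zero_right)
  next
    case False
    then obtain m :: nat where m: "real m * \<eta> \<le> s - (v + \<eta>)" "b ^ m * gps_nth h s \<in> ?R"
      using hw by (auto simp: weighted_def denom_bounded_def)
    have "real m * \<eta> \<le> real j" using m(1) that v0 \<eta>(1) by linarith
    also have "\<dots> \<le> real (M * j) * \<eta>" using mult_right_mono[OF M, of "real j"] by (simp add: ac_simps)
    finally have "real m \<le> real (M * j)" using \<eta>(1) mult_right_le_imp_le by blast
    then have "m \<le> M * j" by (simp only: of_nat_le_iff)
    then have "b ^ (M * j) * gps_nth h s = b ^ (M * j - m) * (b ^ m * gps_nth h s)"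
      by (simp flip: power_add mult.assoc)
    then show ?thesis using R.mult_mem[OF R.power_mem[OF b] m(2)] by metis
  qed
  \<comment> \<open>In the power \<open>j + 1\<close> of \<open>c * b ^ M\<close>, the factor
    \<open>b ^ (M * j)\<close> clears \<open>h\<close>, and the extra 1 provides the
    \<open>c\<close> that \<open>f0\<close> requires even for \<open>j = 0\<close>.\<close>
  have "c * b ^ M \<in> ?R" using c(1) b by (intro R.mult_mem R.power_mem)
  then obtain a where a: "to_fract a = c * b ^ M" by (metis imageE)
  show ?thesis
  proof (intro exI[of _ a] conjI allI impI)
    show "a \<noteq> 0" using a c(2) \<open>b \<noteq> 0\<close> by auto
    fix s :: real
    define j where "j = nat \<lceil>s\<rceil>"
    have "s \<le> real j" unfolding j_def by (rule real_nat_ceiling_ge)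
    moreover have "c * gps_nth f0 s \<in> ?R"
      using c(3) by (simp add: gps_over_def gps_nth_const_mult)
    ultimately have "c * (b ^ (M * j) * gps_nth h s) + b ^ (M * j) * (c * gps_nth f0 s) \<in> ?R"
      using R.add_mem[OF R.mult_mem[OF c(1) hs] R.mult_mem[OF R.power_mem[OF b]]] by blast
    \<comment> \<open>The surplus \<open>c ^ j * b ^ M\<close> completes
      \<open>c * b ^ (M * j)\<close> to the full power of \<open>a\<close>.\<close>
    then have "c ^ j * b ^ M * (c * (b ^ (M * j) * gps_nth h s) + b ^ (M * j) * (c * gps_nth f0 s)) \<in> ?R"
      using R.mult_mem[OF R.mult_mem[OF R.power_mem[OF c(1)] R.power_mem[OF b]]] by blast
    moreover have "gps_nth f s = gps_nth h s + gps_nth f0 s" by (simp add: h_def gps_nth_diff)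
    ultimately show "to_fract a ^ (nat \<lceil>s\<rceil> + 1) * gps_nth f s \<in> ?R"
      unfolding a j_def[symmetric]
      by (simp add: power_mult_distrib power_mult algebra_simps)
  qed
qed

end
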